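(* Let $S$ be a BC Stein AG-groupoid. Then: (a) $S$ is locally associative, i.e. $a(aa)=(aa)a$ for all $a\in S$; (b) $S$ is right alternative, i.e. $a(bb)=(ab)b$ for all $a,b\in S$; (c) $S$ is an AG$^{**}$-groupoid, i.e. $a(bc)=b(ac)$ for all $a,b,c\in S$; (d) $S$ is a Bol$^{*}$-AG-groupoid, i.e. $a((bc)d)=((ab)c)d$ for all $a,b,c,d\in S$; (e) $S$ is paramedial, i.e. $(ab)(cd)=(db)(ca)$ for all $a,b,c,d\in S$; (f) $S$ is left nuclear square, i.e. $(a^{2}b)c=a^{2}(bc)$ for all $a,b,c\in S$; (g) $S$ is right nuclear square, i.e. $(ab)c^{2}=a(bc^{2})$ for all $a,b,c\in S$; (h) $S$ is middle nuclear square, i.e. $(ab^{2})c=a(b^{2}c)$ for all $a,b,c\in S$; (i) $S$ is nuclear square, i.e. it is left, right and middle nuclear square.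
   Context: A groupoid is a set with a binary operation, written as juxtaposition; $a^2=aa$. An AG-groupoid is a groupoid $S$ satisfying the left invertive law $(ab)c=(cb)a$ for all $a,b,c\in S$. A BC Stein AG-groupoid is an AG-groupoid $S$ satisfying $a(bc)=(bc)a$ for all $a,b,c\in S$. *)

theory Defs
  imports Main
begin

(* Groupoid in the sense of magma, not of category theory. *)
locale groupoid =
  fixes S :: "'a set" and mult :: "'a \<Rightarrow> 'a \<Rightarrow> 'a" (infixl \<open>\<cdot>\<close> 70)
  assumes closed: "a \<in> S \<Longrightarrow> b \<in> S \<Longrightarrow> a \<cdot> b \<in> S"

locale AG_groupoid = groupoid +
  assumes left_invertive:
    "a \<in> S \<Longrightarrow> b \<in> S \<Longrightarrow> c \<in> S \<Longrightarrow> (a \<cdot> b) \<cdot> c = (c \<cdot> b) \<cdot> a"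

locale BC_Stein_AG_groupoid = AG_groupoid +
  assumes BC_Stein:
    "a \<in> S \<Longrightarrow> b \<in> S \<Longrightarrow> c \<in> S \<Longrightarrow> a \<cdot> (b \<cdot> c) = (b \<cdot> c) \<cdot> a"

locale locally_associative_AG_groupoid = AG_groupoid +
  assumes locally_associative: "a \<in> S \<Longrightarrow> a \<cdot> (a \<cdot> a) = (a \<cdot> a) \<cdot> a"

locale right_alternative_AG_groupoid = AG_groupoid +
  assumes right_alternative:
    "a \<in> S \<Longrightarrow> b \<in> S \<Longrightarrow> a \<cdot> (b \<cdot> b) = (a \<cdot> b) \<cdot> b"

locale AG_star_star_groupoid = AG_groupoid +
  assumes AG_star_star:
    "a \<in> S \<Longrightarrow> b \<in> S \<Longrightarrow> c \<in> S \<Longrightarrow> a \<cdot> (b \<cdot> c) = b \<cdot> (a \<cdot> c)"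

locale Bol_star_AG_groupoid = AG_groupoid +
  assumes Bol_star:
    "a \<in> S \<Longrightarrow> b \<in> S \<Longrightarrow> c \<in> S \<Longrightarrow> d \<in> S
      \<Longrightarrow> a \<cdot> ((b \<cdot> c) \<cdot> d) = ((a \<cdot> b) \<cdot> c) \<cdot> d"

locale paramedial_AG_groupoid = AG_groupoid +
  assumes paramedial:
    "a \<in> S \<Longrightarrow> b \<in> S \<Longrightarrow> c \<in> S \<Longrightarrow> d \<in> S
      \<Longrightarrow> (a \<cdot> b) \<cdot> (c \<cdot> d) = (d \<cdot> b) \<cdot> (c \<cdot> a)"

locale left_nuclear_square_AG_groupoid = AG_groupoid +
  assumes left_nuclear_square:
    "a \<in> S \<Longrightarrow> b \<in> S \<Longrightarrow> c \<in> S
      \<Longrightarrow> ((a \<cdot> a) \<cdot> b) \<cdot> c = (a \<cdot> a) \<cdot> (b \<cdot> c)"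

locale right_nuclear_square_AG_groupoid = AG_groupoid +
  assumes right_nuclear_square:
    "a \<in> S \<Longrightarrow> b \<in> S \<Longrightarrow> c \<in> S
      \<Longrightarrow> (a \<cdot> b) \<cdot> (c \<cdot> c) = a \<cdot> (b \<cdot> (c \<cdot> c))"

locale middle_nuclear_square_AG_groupoid = AG_groupoid +
  assumes middle_nuclear_square:
    "a \<in> S \<Longrightarrow> b \<in> S \<Longrightarrow> c \<in> S
      \<Longrightarrow> (a \<cdot> (b \<cdot> b)) \<cdot> c = a \<cdot> ((b \<cdot> b) \<cdot> c)"

locale nuclear_square_AG_groupoid =
  left_nuclear_square_AG_groupoid + right_nuclear_square_AG_groupoid +
  middle_nuclear_square_AG_groupoid

end

theory Submission
  imports Defs
begin

text \<open>The BC Stein law makes every product commute with every element. Combined with the left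
  invertive law \<open>(a \<cdot> b) \<cdot> c = (c \<cdot> b) \<cdot> a\<close>, it gives \<open>a
  \<cdot> (b \<cdot> c) = (b \<cdot> c) \<cdot> a = (a \<cdot> c) \<cdot> b = b \<cdot> (a \<cdot>
  c)\<close>. This chain already contains right alternativity and the AG** law
  (\<open>mult_left_commute\<close>). Moving factors in and out by left commutation then yields
  \<open>paramedial\<close>, and with \<open>medial\<close> the Bol* and nuclear square
  laws.\<close>

context AG_groupoid
begin

text \<open>Valid in every AG-groupoid: the left invertive law is applied outside, inside and
  outside again, with no use of the BC Stein law.\<close>

lemma medial:
  assumes "a \<in> S" "b \<in> S" "c \<in> S" "d \<in> S"
  shows "(a \<cdot> b) \<cdot> (c \<cdot> d) = (a \<cdot> c) \<cdot> (b \<cdot> d)"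
proof -
  have "(a \<cdot> b) \<cdot> (c \<cdot> d) = ((c \<cdot> d) \<cdot> b) \<cdot> a"
    using assms by (intro left_invertive closed)
  also have "\<dots> = ((b \<cdot> d) \<cdot> c) \<cdot> a"
    using assms by (simp only: left_invertive[of c d b])
  also have "\<dots> = (a \<cdot> c) \<cdot> (b \<cdot> d)"
    using assms by (intro left_invertive closed)
  finally show ?thesis .
qed

end

context BC_Stein_AG_groupoid
begin

text \<open>The law \<open>BC_Stein\<close> brings the product to the left, where the left invertive
  law applies. Setting \<open>c = b\<close> gives right alternativity.\<close>

lemma mult_mult_eq_right_swap:
  assumes "a \<in> S" "b \<in> S" "c \<in> S"
  shows "a \<cdot> (b \<cdot> c) = (a \<cdot> c) \<cdot> b"
  using assms by (simp only: BC_Stein left_invertive[of b c a])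

lemma mult_left_commute:
  assumes "a \<in> S" "b \<in> S" "c \<in> S"
  shows "a \<cdot> (b \<cdot> c) = b \<cdot> (a \<cdot> c)"
  using assms by (simp only: mult_mult_eq_right_swap[of a b c] BC_Stein[of b a c])

text \<open>Pulling \<open>c\<close> out by left commutation exposes
  \<open>(a \<cdot> b) \<cdot> d\<close>, in which the left invertive law exchanges \<open>a\<close>
  and \<open>d\<close>; \<open>c\<close> is then put back.\<close>

lemma paramedial:
  assumes "a \<in> S" "b \<in> S" "c \<in> S" "d \<in> S"
  shows "(a \<cdot> b) \<cdot> (c \<cdot> d) = (d \<cdot> b) \<cdot> (c \<cdot> a)"
proof -
  have "(a \<cdot> b) \<cdot> (c \<cdot> d) = c \<cdot> ((a \<cdot> b) \<cdot> d)"
    using assms by (intro mult_left_commute closed)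
  also have "\<dots> = c \<cdot> ((d \<cdot> b) \<cdot> a)"
    using assms by (simp only: left_invertive[of a b d])
  also have "\<dots> = (d \<cdot> b) \<cdot> (c \<cdot> a)"
    using assms by (intro mult_left_commute closed)
  finally show ?thesis .
qed

lemma Bol_star:
  assumes "a \<in> S" "b \<in> S" "c \<in> S" "d \<in> S"
  shows "a \<cdot> ((b \<cdot> c) \<cdot> d) = ((a \<cdot> b) \<cdot> c) \<cdot> d"
proof -
  have "a \<cdot> ((b \<cdot> c) \<cdot> d) = (b \<cdot> c) \<cdot> (a \<cdot> d)"
    using assms by (intro mult_left_commute closed)
  also have "\<dots> = (d \<cdot> c) \<cdot> (a \<cdot> b)"
    using assms by (intro paramedial)
  also have "\<dots> = ((a \<cdot> b) \<cdot> c) \<cdot> d"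
    using assms by (intro left_invertive closed)
  finally show ?thesis .
qed

lemma left_nuclear_square:
  assumes "a \<in> S" "b \<in> S" "c \<in> S"
  shows "((a \<cdot> a) \<cdot> b) \<cdot> c = (a \<cdot> a) \<cdot> (b \<cdot> c)"
proof -
  have "((a \<cdot> a) \<cdot> b) \<cdot> c = (c \<cdot> b) \<cdot> (a \<cdot> a)"
    using assms by (intro left_invertive closed)
  \<comment> \<open>Paramediality splits the square into one \<open>a\<close> per factor; the medial
    law reunites them on the left.\<close>
  also have "\<dots> = (a \<cdot> b) \<cdot> (a \<cdot> c)"
    using assms by (intro paramedial)
  also have "\<dots> = (a \<cdot> a) \<cdot> (b \<cdot> c)"
    using assms by (intro medial)
  finally show ?thesis .
qed

text \<open>The square enters only as a product, which therefore commutes with both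
  \<open>a \<cdot> b\<close> and \<open>b\<close>.\<close>

lemma right_nuclear_square:
  assumes "a \<in> S" "b \<in> S" "c \<in> S"
  shows "(a \<cdot> b) \<cdot> (c \<cdot> c) = a \<cdot> (b \<cdot> (c \<cdot> c))"
proof -
  have "(a \<cdot> b) \<cdot> (c \<cdot> c) = (c \<cdot> c) \<cdot> (a \<cdot> b)"
    using assms by (intro BC_Stein closed)
  also have "\<dots> = a \<cdot> ((c \<cdot> c) \<cdot> b)"
    using assms by (intro mult_left_commute closed)
  also have "\<dots> = a \<cdot> (b \<cdot> (c \<cdot> c))"
    using assms by (simp only: BC_Stein[of b c c])
  finally show ?thesis .
qed

lemma middle_nuclear_square:
  assumes "a \<in> S" "b \<in> S" "c \<in> S"
  shows "(a \<cdot> (b \<cdot> b)) \<cdot> c = a \<cdot> ((b \<cdot> b) \<cdot> c)"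
proof -
  have "(a \<cdot> (b \<cdot> b)) \<cdot> c = ((b \<cdot> b) \<cdot> a) \<cdot> c"
    using assms by (simp only: BC_Stein[of a b b])
  also have "\<dots> = (b \<cdot> b) \<cdot> (a \<cdot> c)"
    using assms by (intro left_nuclear_square)
  also have "\<dots> = a \<cdot> ((b \<cdot> b) \<cdot> c)"
    using assms by (intro mult_left_commute closed)
  finally show ?thesis .
qed

end

theorem proposition1:
  fixes S :: "'a set" and mult :: "'a \<Rightarrow> 'a \<Rightarrow> 'a"
  assumes "BC_Stein_AG_groupoid S mult"
  shows "locally_associative_AG_groupoid S mult
    \<and> right_alternative_AG_groupoid S mult
    \<and> AG_star_star_groupoid S mult
    \<and> Bol_star_AG_groupoid S mult
    \<and> paramedial_AG_groupoid S mult
    \<and> left_nuclear_square_AG_groupoid S mult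
    \<and> right_nuclear_square_AG_groupoid S mult
    \<and> middle_nuclear_square_AG_groupoid S mult
    \<and> nuclear_square_AG_groupoid S mult"
proof -
  interpret BC_Stein_AG_groupoid S mult by (fact assms)
  interpret locally_associative_AG_groupoid S mult
    by unfold_locales (rule BC_Stein)
  interpret right_alternative_AG_groupoid S mult
    by unfold_locales (rule mult_mult_eq_right_swap)
  interpret AG_star_star_groupoid S mult
    by unfold_locales (rule mult_left_commute)
  interpret Bol_star_AG_groupoid S mult
    by unfold_locales (rule Bol_star)
  interpret paramedial_AG_groupoid S mult
    by unfold_locales (rule paramedial)
  interpret left_nuclear_square_AG_groupoid S mult
    by unfold_locales (rule left_nuclear_square)
  interpret right_nuclear_square_AG_groupoid S mult
    by unfold_locales (rule right_nuclear_square)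
  interpret middle_nuclear_square_AG_groupoid S mult
    by unfold_locales (rule middle_nuclear_square)
  \<comment> \<open>Nuclear square adds no axiom to its three parents, so the interpretations above
    settle this conjunct too.\<close>
  show ?thesis by (intro conjI) unfold_locales
qed

end
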